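(* Let $n\geq 4$. Among all connected graphs on $n$ vertices with exactly one pendant vertex, the lollipop graph $U_{n,3}^l$ has the minimum core index.
   Context: All graphs are finite, simple and undirected. A pendant vertex is a vertex of degree one. The lollipop graph $U_{n,3}^l$ is obtained from a triangle $C_3$ and a path on $n-2$ vertices by identifying one end vertex of the path with a vertex of the triangle. A connected subgraph of a graph $G=(V,E)$ is a graph $(V',E')$ with $\emptyset\neq V'\subseteq V$, $E'\subseteq E$, every edge of $E'$ having both endpoints in $V'$, and $(V',E')$ connected; distinct pairs $(V',E')$ are counted separately. The core index $F(G)$ is the number of connected subgraphs of $G$. *)

theory Defs
  imports Main
begin

type_synonym 'a ugraph = "'a set \<times> 'a set set"

abbreviation verts :: "'a ugraph \<Rightarrow> 'a set" where "verts G \<equiv> fst G"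
abbreviation edges :: "'a ugraph \<Rightarrow> 'a set set" where "edges G \<equiv> snd G"

definition simple_graph :: "'a ugraph \<Rightarrow> bool" where
  "simple_graph G \<longleftrightarrow> finite (verts G) \<and> (\<forall>e\<in>edges G. e \<subseteq> verts G \<and> card e = 2)"

definition adj_rel :: "'a ugraph \<Rightarrow> ('a \<times> 'a) set" where
  "adj_rel G = {(u, v). {u, v} \<in> edges G}"

definition connected_graph :: "'a ugraph \<Rightarrow> bool" where
  "connected_graph G \<longleftrightarrow>
     verts G \<noteq> {} \<and> (\<forall>u\<in>verts G. \<forall>v\<in>verts G. (u, v) \<in> (adj_rel G)\<^sup>*)"

definition degree :: "'a ugraph \<Rightarrow> 'a \<Rightarrow> nat" where
  "degree G v = card {e \<in> edges G. v \<in> e}"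

definition pendant :: "'a ugraph \<Rightarrow> 'a \<Rightarrow> bool" where
  "pendant G v \<longleftrightarrow> v \<in> verts G \<and> degree G v = 1"

definition connected_subgraphs :: "'a ugraph \<Rightarrow> 'a ugraph set" where
  "connected_subgraphs G =
     {(V', E'). V' \<noteq> {} \<and> V' \<subseteq> verts G \<and> E' \<subseteq> edges G \<and> (\<forall>e\<in>E'. e \<subseteq> V') \<and>
                connected_graph (V', E')}"

definition core_index :: "'a ugraph \<Rightarrow> nat" where
  "core_index G = card (connected_subgraphs G)"

definition one_pendant_graph :: "nat \<Rightarrow> 'a ugraph \<Rightarrow> bool" where
  "one_pendant_graph n G \<longleftrightarrow>
     simple_graph G \<and> connected_graph G \<and> card (verts G) = n \<and> card {v. pendant G v} = 1"

text \<open>The triangle has vertices 0, 1, 2, and the path on \<open>n - 2\<close> vertices runs through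
  2, 3, ..., \<open>n - 1\<close>; they share the vertex 2. Meaningful for \<open>n \<ge> 3\<close>.\<close>
definition lollipop :: "nat \<Rightarrow> nat ugraph" where
  "lollipop n =
     ({0..<n}, {{0, 1}, {1, 2}, {0, 2}} \<union> {{i, i + 1} | i. 2 \<le> i \<and> i + 1 < n})"

end

theory Submission
  imports Defs
begin

text \<open>
  Write \<open>F\<^sub>w\<close> for the number of connected subgraphs containing the vertex \<open>w\<close>. Attaching a new
  leaf \<open>v\<close> at \<open>w\<close> increases the core index by \<open>1 + F\<^sub>w\<close>, and \<open>F\<^sub>v\<close> becomes \<open>1 + F\<^sub>w\<close>. Starting from
  the triangle, the lollipop on \<open>n\<close> vertices therefore has core index \<open>(n\<^sup>2 + 9n - 16) / 2\<close> and
  \<open>n + 4\<close> connected subgraphs through its end.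

  Conversely, a connected graph with a single pendant vertex contains a cycle of some length \<open>c\<close>,
  which misses the pendant vertex, so the cycle can be grown to all vertices by attaching at
  least one leaf. The cycle has at least \<open>c\<^sup>2 + 1\<close> connected subgraphs, and \<open>c(c+1)/2 + 1\<close> through
  each vertex. The first leaf already brings the core index up to that of the lollipop (the cycles
  of length 4 and 5 themselves are below it), and each further leaf adds at least as much as for
  the lollipop, because \<open>F\<^sub>w \<ge> m + 4\<close> persists on \<open>m\<close> vertices.
\<close>

definition connected_subgraphs_at :: "'a ugraph \<Rightarrow> 'a \<Rightarrow> 'a ugraph set" where
  "connected_subgraphs_at G w = {H \<in> connected_subgraphs G. w \<in> verts H}"

text \<open>Freshness of \<open>v\<close> is left to the lemmas, so that the same operation serves
  for graphs, for their connected subgraphs, and for building paths vertex by vertex.\<close>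

definition add_leaf :: "'a ugraph \<Rightarrow> 'a \<Rightarrow> 'a \<Rightarrow> 'a ugraph" where
  "add_leaf G v w = (insert v (verts G), insert {v, w} (edges G))"

lemma verts_add_leaf [simp]: "verts (add_leaf G v w) = insert v (verts G)"
  and edges_add_leaf [simp]: "edges (add_leaf G v w) = insert {v, w} (edges G)"
  by (simp_all add: add_leaf_def)

section \<open>Connectedness\<close>

lemma sym_adj_rel: "sym (adj_rel G)"
  by (auto simp: sym_def adj_rel_def insert_commute)

lemma adj_rel_rtrancl_sym: "(u, v) \<in> (adj_rel G)\<^sup>* \<Longrightarrow> (v, u) \<in> (adj_rel G)\<^sup>*"
  using sym_rtrancl[OF sym_adj_rel] by (rule symD)

lemma adj_rel_mono: "edges G \<subseteq> edges H \<Longrightarrow> adj_rel G \<subseteq> adj_rel H"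
  by (auto simp: adj_rel_def)

lemma connected_graph_rootI:
  assumes "r \<in> verts G" "\<And>x. x \<in> verts G \<Longrightarrow> (r, x) \<in> (adj_rel G)\<^sup>*"
  shows "connected_graph G"
  unfolding connected_graph_def
  using assms by (blast intro: adj_rel_rtrancl_sym rtrancl_trans)

lemma connected_graph_insert_edge:
  assumes "connected_graph (V, E)"
  shows "connected_graph (V, insert e E)"
proof -
  have "(adj_rel (V, E))\<^sup>* \<subseteq> (adj_rel (V, insert e E))\<^sup>*"
    by (intro rtrancl_mono adj_rel_mono) auto
  with assms show ?thesis by (auto simp: connected_graph_def)
qed

lemma connected_graph_add_leaf:
  assumes "connected_graph G" "w \<in> verts G"
  shows "connected_graph (add_leaf G v w)"
proof (rule connected_graph_rootI)
  show "w \<in> verts (add_leaf G v w)" using assms by simp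
next
  fix x assume x: "x \<in> verts (add_leaf G v w)"
  have sub: "(adj_rel G)\<^sup>* \<subseteq> (adj_rel (add_leaf G v w))\<^sup>*"
    by (intro rtrancl_mono adj_rel_mono) auto
  have "(w, v) \<in> adj_rel (add_leaf G v w)"
    by (auto simp: adj_rel_def insert_commute)
  with x assms sub show "(w, x) \<in> (adj_rel (add_leaf G v w))\<^sup>*"
    by (auto simp: connected_graph_def)
qed

lemma connected_graph_singleton: "connected_graph ({v}, E)"
  by (simp add: connected_graph_def)

lemma connected_graph_delete_leaf:
  assumes conn: "connected_graph (add_leaf G v w)"
    and v: "v \<notin> verts G" and w: "w \<in> verts G" and E: "\<forall>e\<in>edges G. e \<subseteq> verts G"
  shows "connected_graph G"
proof (rule connected_graph_rootI[OF w])
  \<comment> \<open>The claim is vacuous at \<open>v\<close> and trivial at \<open>w\<close>; any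
    other vertex is entered by an edge of \<open>G\<close>, whose earlier endpoint is not
    \<open>v\<close>.\<close>
  have *: "x \<noteq> v \<longrightarrow> (w, x) \<in> (adj_rel G)\<^sup>*"
    if "(w, x) \<in> (adj_rel (add_leaf G v w))\<^sup>*" for x
    using that
  proof (induction rule: rtrancl_induct)
    case base
    then show ?case by simp
  next
    case (step y z)
    have yz: "{y, z} \<in> insert {v, w} (edges G)"
      using step.hyps by (simp add: adj_rel_def)
    show ?case
    proof (cases "z = v \<or> z = w")
      case False
      with yz have e: "{y, z} \<in> edges G" by (auto simp: doubleton_eq_iff)
      with E v have "y \<noteq> v" by auto
      with step.IH have "(w, y) \<in> (adj_rel G)\<^sup>*" by simp
      moreover have "(y, z) \<in> adj_rel G" using e by (simp add: adj_rel_def)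
      ultimately show ?thesis using False by auto
    qed auto
  qed
  fix x assume x: "x \<in> verts G"
  with conn w have "(w, x) \<in> (adj_rel (add_leaf G v w))\<^sup>*"
    by (simp add: connected_graph_def)
  from *[OF this] x v show "(w, x) \<in> (adj_rel G)\<^sup>*" by auto
qed

lemma connected_graph_incident_edge:
  assumes "connected_graph G" "u \<in> verts G" "x \<in> verts G" "u \<noteq> x"
  obtains y where "{u, y} \<in> edges G"
proof -
  have "(u, x) \<in> (adj_rel G)\<^sup>*" using assms by (simp add: connected_graph_def)
  then show thesis
    using assms(4) that by (cases rule: converse_rtranclE) (auto simp: adj_rel_def)
qed

text \<open>A walk from inside \<open>S\<close> to a vertex outside crosses the boundary of
  \<open>S\<close>. This supplies the next leaf when a subgraph is grown to all vertices.\<close>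

lemma connected_graph_exit_edge:
  assumes "simple_graph G" "connected_graph G" "S \<subset> verts G" "S \<noteq> {}"
  obtains v w where "v \<in> verts G - S" "w \<in> S" "{v, w} \<in> edges G"
proof -
  obtain a b where a: "a \<in> S" and b: "b \<in> verts G" "b \<notin> S" using assms by blast
  have "(a, b) \<in> (adj_rel G)\<^sup>*" using assms a b by (auto simp: connected_graph_def)
  then have "b \<in> S \<or> (\<exists>v w. v \<in> verts G - S \<and> w \<in> S \<and> {v, w} \<in> edges G)"
  proof (induction rule: rtrancl_induct)
    case base
    then show ?case using a by simp
  next
    case (step y z)
    have e: "{z, y} \<in> edges G" using step.hyps by (simp add: adj_rel_def insert_commute)
    then have "z \<in> verts G" using assms(1) by (auto simp: simple_graph_def)
    with step.IH e show ?case by blast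
  qed
  with b that show thesis by blast
qed

section \<open>Counting connected subgraphs\<close>

lemma connected_subgraphsI:
  assumes "connected_graph H" "verts H \<subseteq> verts G" "edges H \<subseteq> edges G" "\<forall>e\<in>edges H. e \<subseteq> verts H"
  shows "H \<in> connected_subgraphs G"
  using assms by (cases H) (auto simp: connected_subgraphs_def connected_graph_def)

lemma connected_subgraphsD:
  assumes "H \<in> connected_subgraphs G"
  shows "connected_graph H" "verts H \<subseteq> verts G" "edges H \<subseteq> edges G" "\<forall>e\<in>edges H. e \<subseteq> verts H"
    "verts H \<noteq> {}"
  using assms unfolding connected_subgraphs_def by (cases H; simp)+

lemma simple_graph_finite_edges: "simple_graph G \<Longrightarrow> finite (edges G)"
  by (rule finite_subset[of _ "Pow (verts G)"]) (auto simp: simple_graph_def)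

lemma finite_connected_subgraphs:
  assumes "simple_graph G"
  shows "finite (connected_subgraphs G)"
proof (rule finite_subset)
  show "connected_subgraphs G \<subseteq> Pow (verts G) \<times> Pow (edges G)"
    by (auto simp: connected_subgraphs_def)
  show "finite (Pow (verts G) \<times> Pow (edges G))"
    using assms simple_graph_finite_edges[OF assms] by (simp add: simple_graph_def)
qed

lemma finite_connected_subgraphs_at:
  "simple_graph G \<Longrightarrow> finite (connected_subgraphs_at G w)"
  by (simp add: connected_subgraphs_at_def finite_connected_subgraphs)

lemma connected_subgraphs_mono:
  "verts U \<subseteq> verts G \<Longrightarrow> edges U \<subseteq> edges G \<Longrightarrow> connected_subgraphs U \<subseteq> connected_subgraphs G"
  by (auto simp: connected_subgraphs_def)

lemma core_index_mono:
  assumes "simple_graph G" "verts U \<subseteq> verts G" "edges U \<subseteq> edges G"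
  shows "core_index U \<le> core_index G"
  unfolding core_index_def
  by (intro card_mono finite_connected_subgraphs connected_subgraphs_mono assms)

section \<open>Attaching a leaf\<close>

lemma simple_graph_add_leaf:
  assumes "simple_graph G" "v \<notin> verts G" "w \<in> verts G"
  shows "simple_graph (add_leaf G v w)"
  using assms by (auto simp: simple_graph_def card_insert_if)

text \<open>A connected subgraph avoiding \<open>v\<close> lies in \<open>G\<close>. One containing
  \<open>v\<close> is the single vertex, or it uses the only edge at \<open>v\<close> and arises
  from a connected subgraph through \<open>w\<close>.\<close>

lemma connected_subgraphs_add_leaf:
  assumes G: "simple_graph G" and v: "v \<notin> verts G" and w: "w \<in> verts G"
  shows "connected_subgraphs (add_leaf G v w) = connected_subgraphs G \<union>
           insert ({v}, {}) ((\<lambda>H. add_leaf H v w) ` connected_subgraphs_at G w)"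
    (is "?L = ?A \<union> insert ?B ?C")
proof
  show "?A \<union> insert ?B ?C \<subseteq> ?L"
  proof -
    have "?A \<subseteq> ?L" by (rule connected_subgraphs_mono) auto
    moreover have "?B \<in> ?L" by (rule connected_subgraphsI) (auto simp: connected_graph_singleton)
    moreover have "add_leaf H v w \<in> ?L" if "H \<in> connected_subgraphs_at G w" for H
    proof -
      from that have H: "H \<in> connected_subgraphs G" and wH: "w \<in> verts H"
        by (auto simp: connected_subgraphs_at_def)
      note D = connected_subgraphsD[OF H]
      show ?thesis
        by (rule connected_subgraphsI) (use D(1-4) wH in \<open>auto intro: connected_graph_add_leaf\<close>)
    qed
    ultimately show ?thesis by blast
  qed
next
  show "?L \<subseteq> ?A \<union> insert ?B ?C"
  proof
    fix H assume "H \<in> ?L"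
    note D = connected_subgraphsD[OF this]
    have EG: "e \<subseteq> verts G" "card e = 2" if "e \<in> edges G" for e
      using G that by (auto simp: simple_graph_def)
    show "H \<in> ?A \<union> insert ?B ?C"
    proof (cases "v \<in> verts H")
      case False
      with D(4) have "{v, w} \<notin> edges H" by auto
      with False D(1-4) have "H \<in> ?A" by (intro connected_subgraphsI) auto
      then show ?thesis ..
    next
      case vH: True
      show ?thesis
      proof (cases "verts H = {v}")
        case True
        have "edges H = {}"
        proof (rule equals0I)
          fix e assume e: "e \<in> edges H"
          with D(4) True have sub: "e \<subseteq> {v}" by auto
          show False
          proof (cases "e \<in> edges G")
            case True
            with EG[of e] sub v have "e = {}" by auto
            with EG[of e] True show False by auto
          next
            case False
            with e D(3) have "e = {v, w}" by auto
            with sub v w show False by auto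
          qed
        qed
        with True have "H = ?B" by (simp add: prod_eq_iff)
        then show ?thesis by simp
      next
        case False
        \<comment> \<open>Since \<open>v\<close> is joined to a further vertex, some edge of
          \<open>H\<close> meets \<open>v\<close>; edges of \<open>G\<close> avoid \<open>v\<close>,
          so it is \<open>{v, w}\<close>. Removing the leaf then gives \<open>K\<close>.\<close>
        with vH obtain x where x: "x \<in> verts H" "v \<noteq> x" by auto
        obtain y where "{v, y} \<in> edges H"
          using connected_graph_incident_edge[OF D(1) vH x] .
        moreover have "{v, y} \<notin> edges G" using EG v by auto
        ultimately have e: "{v, w} \<in> edges H" using D(3) by (metis edges_add_leaf insertE subsetD)
        with D(4) have wH: "w \<in> verts H" by auto
        define K where "K = (verts H - {v}, edges H - {{v, w}})"
        have HK: "H = add_leaf K v w"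
          using vH e by (simp add: K_def add_leaf_def prod_eq_iff insert_absorb)
        have wK: "w \<in> verts K" using wH v w by (auto simp: K_def)
        have EK: "edges K \<subseteq> edges G" using D(3) by (auto simp: K_def)
        have EK2: "\<forall>e\<in>edges K. e \<subseteq> verts K"
        proof
          fix e assume e: "e \<in> edges K"
          with EK EG v have "v \<notin> e" by auto
          with e D(4) show "e \<subseteq> verts K" by (auto simp: K_def)
        qed
        have "v \<notin> verts K" by (simp add: K_def)
        with D(1)[unfolded HK] have "connected_graph K"
          using wK EK2 by (rule connected_graph_delete_leaf)
        then have "K \<in> connected_subgraphs G"
          by (rule connected_subgraphsI) (use D(2) EK EK2 in \<open>auto simp: K_def\<close>)
        with wK have "K \<in> connected_subgraphs_at G w" by (simp add: connected_subgraphs_at_def)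
        with HK show ?thesis by blast
      qed
    qed
  qed
qed

lemma inj_on_add_leaf:
  assumes "\<And>H. H \<in> A \<Longrightarrow> v \<notin> verts H" "\<And>H. H \<in> A \<Longrightarrow> {v, w} \<notin> edges H"
  shows "inj_on (\<lambda>H. add_leaf H v w) A"
proof (rule inj_onI)
  fix H K assume *: "H \<in> A" "K \<in> A" "add_leaf H v w = add_leaf K v w"
  then have "insert v (verts H) = insert v (verts K)"
    "insert {v, w} (edges H) = insert {v, w} (edges K)"
    by (auto simp: add_leaf_def)
  with *(1,2) assms[of H] assms[of K] show "H = K"
    by (simp add: prod_eq_iff insert_ident)
qed

context
  fixes G :: "'a ugraph" and v w :: 'a
  assumes G: "simple_graph G" and v: "v \<notin> verts G" and w: "w \<in> verts G"
begin

lemma v_notin_connected_subgraph: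
  assumes "H \<in> connected_subgraphs G"
  shows "v \<notin> verts H" "{v, w} \<notin> edges H"
  using connected_subgraphsD(2,4)[OF assms] v by blast+

text \<open>The single vertex \<open>v\<close> has no edge, whereas every image contains
  \<open>{v, w}\<close>; and the leaf can be removed again, so no two images coincide.\<close>

lemma card_leaf_subgraphs:
  "card (insert ({v}, {}) ((\<lambda>H. add_leaf H v w) ` connected_subgraphs_at G w)) =
     Suc (card (connected_subgraphs_at G w))" (is "card (insert ?B ?C) = _")
proof -
  have "?B \<notin> ?C" by (auto simp: add_leaf_def)
  moreover have "finite ?C" using G by (simp add: finite_connected_subgraphs_at)
  moreover have "card ?C = card (connected_subgraphs_at G w)"
    by (intro card_image inj_on_add_leaf)
      (auto simp: connected_subgraphs_at_def v_notin_connected_subgraph)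
  ultimately show ?thesis by simp
qed

lemma core_index_add_leaf:
  "core_index (add_leaf G v w) = core_index G + Suc (card (connected_subgraphs_at G w))"
proof -
  let ?D = "insert ({v}, {}) ((\<lambda>H. add_leaf H v w) ` connected_subgraphs_at G w)"
  have "connected_subgraphs G \<inter> ?D = {}"
    using v_notin_connected_subgraph(1) by fastforce
  then have "card (connected_subgraphs G \<union> ?D) = card (connected_subgraphs G) + card ?D"
    using G by (intro card_Un_disjoint)
      (auto simp: finite_connected_subgraphs finite_connected_subgraphs_at)
  then show ?thesis
    unfolding core_index_def connected_subgraphs_add_leaf[OF G v w] card_leaf_subgraphs .
qed

lemma card_connected_subgraphs_at_new_leaf:
  "card (connected_subgraphs_at (add_leaf G v w) v) = Suc (card (connected_subgraphs_at G w))"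
proof -
  have "connected_subgraphs_at (add_leaf G v w) v =
      insert ({v}, {}) ((\<lambda>H. add_leaf H v w) ` connected_subgraphs_at G w)"
    unfolding connected_subgraphs_at_def[of "add_leaf G v w"] connected_subgraphs_add_leaf[OF G v w]
    using v_notin_connected_subgraph(1) by auto
  then show ?thesis by (simp only: card_leaf_subgraphs)
qed

text \<open>All old subgraphs through \<open>x\<close> survive, and the whole enlarged graph is a
  new one. A gain of one is exactly what a bound of the form number of vertices plus 4
  requires.\<close>

lemma card_connected_subgraphs_at_add_leaf:
  assumes "connected_graph G" "x \<in> verts G"
  shows "card (connected_subgraphs_at G x) < card (connected_subgraphs_at (add_leaf G v w) x)"
proof (rule psubset_card_mono)
  show "finite (connected_subgraphs_at (add_leaf G v w) x)"
    by (intro finite_connected_subgraphs_at simple_graph_add_leaf G v w)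
  have "G \<in> connected_subgraphs G"
    using assms G by (intro connected_subgraphsI) (auto simp: simple_graph_def)
  then have "add_leaf G v w \<in> connected_subgraphs_at (add_leaf G v w) x"
    using w assms
    by (auto simp: connected_subgraphs_at_def connected_subgraphs_add_leaf[OF G v w])
  moreover have "add_leaf G v w \<notin> connected_subgraphs_at G x"
    using v_notin_connected_subgraph(1)[of "add_leaf G v w"] by (auto simp: connected_subgraphs_at_def)
  moreover have "connected_subgraphs_at G x \<subseteq> connected_subgraphs_at (add_leaf G v w) x"
    by (auto simp: connected_subgraphs_at_def connected_subgraphs_add_leaf[OF G v w])
  ultimately show "connected_subgraphs_at G x \<subset> connected_subgraphs_at (add_leaf G v w) x"
    by blast
qed

end

section \<open>The lollipop\<close>

lemma lollipop_3: "lollipop 3 = ({0, 1, 2}, {{0, 1}, {1, 2}, {0, 2}})"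
  by (auto simp: lollipop_def)

text \<open>The added edge is the path edge with \<open>i = n - 1\<close>, which satisfies
  \<open>2 \<le> i\<close> because \<open>n \<ge> 3\<close>. So lollipops grow from the triangle by
  leaves at the current end.\<close>

lemma lollipop_Suc:
  assumes "n \<ge> 3"
  shows "lollipop (Suc n) = add_leaf (lollipop n) n (n - 1)"
proof -
  have "{{i, i + 1} |i. 2 \<le> i \<and> i + 1 < Suc n} =
      insert {n, n - 1} {{i, i + 1} |i. 2 \<le> i \<and> i + 1 < n}" (is "?L = ?R")
  proof
    have "{i, i + 1} \<in> ?R" if "2 \<le> i" "i + 1 < Suc n" for i
    proof (cases "i + 1 = n")
      case True
      then have "{i, i + 1} = {n, n - 1}" by auto
      then show ?thesis by blast
    qed (use that in auto)
    then show "?L \<subseteq> ?R" by blast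
    have "{n, n - 1} = {n - 1, n - 1 + 1}" using assms by auto
    moreover have "2 \<le> n - 1 \<and> n - 1 + 1 < Suc n" using assms by auto
    ultimately have "{n, n - 1} \<in> ?L" by blast
    moreover have "{{i, i + 1} |i. 2 \<le> i \<and> i + 1 < n} \<subseteq> ?L" by (auto intro: less_SucI)
    ultimately show "?R \<subseteq> ?L" by (rule insert_subsetI)
  qed
  then show ?thesis
    by (simp add: lollipop_def add_leaf_def atLeast0_lessThan_Suc insert_commute)
qed

lemma verts_lollipop [simp]: "verts (lollipop n) = {0..<n}"
  by (simp add: lollipop_def)

lemma simple_connected_lollipop:
  assumes "n \<ge> 3"
  shows "simple_graph (lollipop n) \<and> connected_graph (lollipop n)"
  using assms
proof (induction n rule: dec_induct)
  case base
  \<comment> \<open>The path 0, 1, 2 is built from two leaves; the edge \<open>{0, 2}\<close> then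
    closes the triangle.\<close>
  have "connected_graph (add_leaf (add_leaf ({0::nat}, {}) 1 0) 2 1)"
    by (intro connected_graph_add_leaf connected_graph_singleton) auto
  also have "add_leaf (add_leaf ({0::nat}, {}) 1 0) 2 1 = ({0, 1, 2}, {{0, 1}, {1, 2}})"
    by (auto simp: add_leaf_def)
  finally have "connected_graph ({0::nat, 1, 2}, insert {0, 2} {{0, 1}, {1, 2}})"
    by (rule connected_graph_insert_edge)
  then have "connected_graph (lollipop 3)"
    by (simp add: lollipop_3 insert_commute)
  moreover have "simple_graph (lollipop 3)"
    by (simp add: lollipop_3 simple_graph_def)
  ultimately show ?case by simp
next
  case (step n)
  then show ?case
    by (simp add: lollipop_Suc simple_graph_add_leaf connected_graph_add_leaf)
qed

text \<open>An inclusion suffices, as the lollipop is only bounded from above. The list consists of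
  three vertices, three edges, three spanning paths and the triangle.\<close>

lemma connected_subgraphs_triangle:
  "connected_subgraphs (lollipop 3) \<subseteq>
     {({0}, {}), ({1}, {}), ({0, 1}, {{0, 1}}),
      ({2}, {}), ({0, 2}, {{0, 2}}), ({1, 2}, {{1, 2}}),
      ({0, 1, 2}, {{0, 1}, {1, 2}}), ({0, 1, 2}, {{0, 1}, {0, 2}}),
      ({0, 1, 2}, {{1, 2}, {0, 2}}), ({0, 1, 2}, {{0, 1}, {1, 2}, {0, 2}})}"
proof
  fix H assume H: "H \<in> connected_subgraphs (lollipop 3)"
  note D = connected_subgraphsD[OF H]
  obtain V E where HVE: "H = (V, E)" by (cases H)
  have V: "V \<in> Pow {0, 1, 2}" and E: "E \<in> Pow {{0, 1}, {1, 2}, {0, 2}}"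
    using D HVE by (auto simp: lollipop_3)
  have sub: "\<forall>e\<in>E. e \<subseteq> V" and ne: "V \<noteq> {}" using D HVE by auto
  \<comment> \<open>On at most three vertices, having no isolated vertex already forces
    connectedness, so this condition eliminates every pair missing from the list.\<close>
  have inc: "\<forall>u\<in>V. \<forall>x\<in>V. u \<noteq> x \<longrightarrow> (\<exists>e\<in>E. u \<in> e)"
    using connected_graph_incident_edge[OF D(1)] HVE by (metis fst_conv snd_conv insertI1)
  show "H \<in> {({0}, {}), ({1}, {}), ({0, 1}, {{0, 1}}),
      ({2}, {}), ({0, 2}, {{0, 2}}), ({1, 2}, {{1, 2}}),
      ({0, 1, 2}, {{0, 1}, {1, 2}}), ({0, 1, 2}, {{0, 1}, {0, 2}}),
      ({0, 1, 2}, {{1, 2}, {0, 2}}), ({0, 1, 2}, {{0, 1}, {1, 2}, {0, 2}})}"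
  proof -
    have "V = {0} \<or> V = {1} \<or> V = {2} \<or> V = {0, 1} \<or> V = {0, 2} \<or> V = {1, 2} \<or> V = {0, 1, 2}"
      using V ne by (simp add: Pow_insert) argo
    moreover have "E = {} \<or> E = {{0, 1}} \<or> E = {{1, 2}} \<or> E = {{0, 2}} \<or> E = {{0, 1}, {1, 2}} \<or>
        E = {{0, 1}, {0, 2}} \<or> E = {{1, 2}, {0, 2}} \<or> E = {{0, 1}, {1, 2}, {0, 2}}"
      using E by (simp add: Pow_insert) argo
    ultimately show ?thesis
      unfolding HVE by (elim disjE; use sub inc in simp)
  qed
qed

text \<open>The closed form is doubled and shifted by 16 to avoid division and subtraction. Both
  bounds are proved together: the new leaf adds at most \<open>n + 5\<close>, and
  \<open>2 * (n + 5)\<close> is the increment of \<open>n * n + 9 * n\<close>.\<close>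

lemma lollipop_counts:
  assumes "n \<ge> 3"
  shows "2 * core_index (lollipop n) + 16 \<le> n * n + 9 * n \<and>
         card (connected_subgraphs_at (lollipop n) (n - 1)) \<le> n + 4"
  using assms
proof (induction n rule: dec_induct)
  case base
  \<comment> \<open>The ten subgraphs are split into three avoiding vertex 2, in \<open>T\<close>,
    and seven containing it, in \<open>T2\<close>; these are the values 10 and 7 needed for
    \<open>n = 3\<close>.\<close>
  define T :: "nat ugraph list" where "T = [({0}, {}), ({1}, {}), ({0, 1}, {{0, 1}})]"
  define T2 :: "nat ugraph list" where
    "T2 = [({2}, {}), ({0, 2}, {{0, 2}}), ({1, 2}, {{1, 2}}),
      ({0, 1, 2}, {{0, 1}, {1, 2}}), ({0, 1, 2}, {{0, 1}, {0, 2}}),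
      ({0, 1, 2}, {{1, 2}, {0, 2}}), ({0, 1, 2}, {{0, 1}, {1, 2}, {0, 2}})]"
  have sub: "connected_subgraphs (lollipop 3) \<subseteq> set (T @ T2)"
    using connected_subgraphs_triangle by (simp add: T_def T2_def)
  then have "core_index (lollipop 3) \<le> length (T @ T2)"
    unfolding core_index_def by (meson List.finite_set card_length card_mono le_trans)
  moreover have "connected_subgraphs_at (lollipop 3) 2 \<subseteq> set T2"
    using sub by (auto simp: connected_subgraphs_at_def T_def)
  then have "card (connected_subgraphs_at (lollipop 3) 2) \<le> length T2"
    by (meson List.finite_set card_length card_mono le_trans)
  ultimately show ?case by (simp add: T_def T2_def)
next
  case (step n)
  have "simple_graph (lollipop n)" "n \<notin> verts (lollipop n)" "n - 1 \<in> verts (lollipop n)"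
    using simple_connected_lollipop[of n] step.hyps by auto
  note c = core_index_add_leaf[OF this] card_connected_subgraphs_at_new_leaf[OF this]
  show ?case
    using step.IH step.hyps c by (simp add: lollipop_Suc)
qed

section \<open>Cycles\<close>

definition cycle_edge :: "(nat \<Rightarrow> 'a) \<Rightarrow> nat \<Rightarrow> nat \<Rightarrow> 'a set" where
  "cycle_edge p c i = {p i, p (Suc i mod c)}"

text \<open>Vertices and edges share the index set \<open>{..<c}\<close>, with edge
  \<open>c - 1\<close> closing the cycle, so that subgraphs can be described by sets of
  indices.\<close>

definition cycle :: "(nat \<Rightarrow> 'a) \<Rightarrow> nat \<Rightarrow> 'a ugraph" where
  "cycle p c = (p ` {..<c}, cycle_edge p c ` {..<c})"

text \<open>Shifting by \<open>c - k\<close> undoes the shift by \<open>k\<close>, which gives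
  surjectivity; on a finite set injectivity follows.\<close>

lemma inj_on_rotate:
  fixes c k :: nat
  assumes "k < c"
  shows "(\<lambda>i. (k + i) mod c) ` {..<c} = {..<c}" "inj_on (\<lambda>i. (k + i) mod c) {..<c}"
proof -
  show eq: "(\<lambda>i. (k + i) mod c) ` {..<c} = {..<c}"
  proof
    show "(\<lambda>i. (k + i) mod c) ` {..<c} \<subseteq> {..<c}" using assms by auto
    show "{..<c} \<subseteq> (\<lambda>i. (k + i) mod c) ` {..<c}"
    proof
      fix j assume j: "j \<in> {..<c}"
      have "(k + (j + (c - k)) mod c) mod c = (j + c) mod c"
        using assms by (simp add: mod_add_right_eq)
      then have "j = (k + (j + (c - k)) mod c) mod c" using j by simp
      then show "j \<in> (\<lambda>i. (k + i) mod c) ` {..<c}" using assms by (intro image_eqI[where x = "(j + (c - k)) mod c"]) auto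
    qed
  qed
  show "inj_on (\<lambda>i. (k + i) mod c) {..<c}"
    by (rule eq_card_imp_inj_on) (simp_all add: eq)
qed

lemma cycle_rotate:
  assumes "k < c"
  shows "cycle (\<lambda>i. p ((k + i) mod c)) c = cycle p c"
proof -
  have "p ` (\<lambda>i. (k + i) mod c) ` {..<c} = p ` {..<c}"
    "cycle_edge p c ` (\<lambda>i. (k + i) mod c) ` {..<c} = cycle_edge p c ` {..<c}"
    by (simp_all only: inj_on_rotate(1)[OF assms])
  moreover have "cycle_edge (\<lambda>i. p ((k + i) mod c)) c i = cycle_edge p c ((k + i) mod c)" for i
    by (simp add: cycle_edge_def mod_Suc_eq mod_add_right_eq)
  ultimately show ?thesis by (simp add: cycle_def image_image)
qed

lemma inj_on_cycle_rotate:
  fixes c k :: nat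
  assumes "k < c" "inj_on p {..<c}"
  shows "inj_on (\<lambda>i. p ((k + i) mod c)) {..<c}"
  using comp_inj_on[OF inj_on_rotate(2)[OF assms(1)], of p] assms inj_on_rotate(1)[OF assms(1)]
  by (simp add: o_def)

lemma two_sum_lessThan: "2 * (\<Sum>b<c. b) + c = c * (c::nat)"
  by (induction c) auto

context
  fixes p :: "nat \<Rightarrow> 'a" and c :: nat
  assumes c: "c \<ge> 3" and p: "inj_on p {..<c}"
begin

text \<open>If two different indices gave the same edge, each would be the cyclic successor of the
  other, which is impossible for \<open>c \<ge> 3\<close>.\<close>

lemma inj_on_cycle_edge: "inj_on (cycle_edge p c) {..<c}"
proof (rule inj_onI)
  fix i j assume ij: "i \<in> {..<c}" "j \<in> {..<c}" and eq: "cycle_edge p c i = cycle_edge p c j"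
  show "i = j"
  proof (rule ccontr)
    assume "i \<noteq> j"
    then have "p i \<noteq> p j" using p ij by (auto dest: inj_onD)
    with eq have "p i = p (Suc j mod c)" "p (Suc i mod c) = p j"
      by (auto simp: cycle_edge_def doubleton_eq_iff)
    then have "i = Suc j mod c" "Suc i mod c = j"
      using inj_onD[OF p] ij c by simp_all
    with c ij show False by (auto simp: mod_Suc split: if_splits)
  qed
qed

lemma simple_graph_cycle: "simple_graph (cycle p c)"
proof -
  have "card (cycle_edge p c i) = 2" "cycle_edge p c i \<subseteq> p ` {..<c}" if "i < c" for i
  proof -
    have "Suc i mod c \<noteq> i" "Suc i mod c < c" using that c by (auto simp: mod_Suc)
    then show "card (cycle_edge p c i) = 2" "cycle_edge p c i \<subseteq> p ` {..<c}"
      using p that by (auto simp: cycle_edge_def card_insert_if dest: inj_onD)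
  qed
  then show ?thesis by (auto simp: simple_graph_def cycle_def)
qed

lemma connected_graph_path:
  assumes "a \<le> b" "b < c"
  shows "connected_graph (p ` {a..b}, cycle_edge p c ` {a..<b})"
  using assms
proof (induction b rule: dec_induct)
  case base
  then show ?case by (simp add: connected_graph_singleton)
next
  case (step b)
  have "connected_graph (add_leaf (p ` {a..b}, cycle_edge p c ` {a..<b}) (p (Suc b)) (p b))"
    using step by (intro connected_graph_add_leaf) auto
  moreover have "{a..Suc b} = insert (Suc b) {a..b}" "{a..<Suc b} = insert b {a..<b}"
    using step.hyps by auto
  moreover have "cycle_edge p c b = {p (Suc b), p b}"
    using step.prems by (auto simp: cycle_edge_def)
  ultimately show ?case by (simp add: add_leaf_def)
qed

lemma connected_graph_cycle: "connected_graph (cycle p c)"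
proof -
  have "{..<c} = {0..c-1}" "{..<c} = insert (c-1) {0..<c-1}" using c by auto
  then have "cycle p c = (p ` {0..c-1}, insert (cycle_edge p c (c-1)) (cycle_edge p c ` {0..<c-1}))"
    by (metis cycle_def image_insert)
  then show ?thesis
    using connected_graph_insert_edge[OF connected_graph_path[of 0 "c-1"]] c by simp
qed

text \<open>This is the arc \<open>b, ..., c - 1, 0, ..., a\<close> through the closing edge. It
  starts as the path \<open>0, ..., a\<close> with \<open>c - 1\<close> attached at 0, and
  \<open>b\<close> then moves down one leaf at a time. For \<open>b = a + 1\<close> it is the
  spanning path without edge \<open>a\<close>.\<close>

lemma connected_graph_wrapped_path:
  assumes "a < b" "b < c"
  shows "connected_graph (p ` ({..a} \<union> {b..<c}), cycle_edge p c ` ({..<a} \<union> {b..<c}))"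
proof -
  have "b \<le> c - 1" using assms by simp
  then show ?thesis using \<open>a < b\<close>
  proof (induction b rule: inc_induct)
    case base
    have "connected_graph (add_leaf (p ` {0..a}, cycle_edge p c ` {0..<a}) (p (c - 1)) (p 0))"
      using base assms by (intro connected_graph_add_leaf connected_graph_path) auto
    moreover have "{..a} \<union> {c - 1..<c} = insert (c - 1) {0..a}"
      "{..<a} \<union> {c - 1..<c} = insert (c - 1) {0..<a}" using c by auto
    moreover have "cycle_edge p c (c - 1) = {p (c - 1), p 0}"
      using c by (simp add: cycle_edge_def)
    ultimately show ?case by (simp add: add_leaf_def)
  next
    case (step b)
    have "connected_graph (add_leaf
      (p ` ({..a} \<union> {Suc b..<c}), cycle_edge p c ` ({..<a} \<union> {Suc b..<c})) (p b) (p (Suc b)))"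
      using step by (intro connected_graph_add_leaf) auto
    moreover have "{..a} \<union> {b..<c} = insert b ({..a} \<union> {Suc b..<c})"
      "{..<a} \<union> {b..<c} = insert b ({..<a} \<union> {Suc b..<c})" using step.hyps by auto
    moreover have "cycle_edge p c b = {p b, p (Suc b)}"
      using step.hyps by (simp add: cycle_edge_def)
    ultimately show ?case by (simp add: add_leaf_def)
  qed
qed

section \<open>Counting connected subgraphs of a cycle by index sets\<close>

definition index_subgraph :: "nat set \<times> nat set \<Rightarrow> 'a ugraph" where
  "index_subgraph X = (p ` fst X, cycle_edge p c ` snd X)"

text \<open>Both \<open>p\<close> and \<open>cycle_edge p c\<close> are injective on indices, so
  counting subgraphs reduces to counting pairs of sets of numbers.\<close>

lemma inj_on_index_subgraph: "inj_on index_subgraph (Pow {..<c} \<times> Pow {..<c})"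
proof (rule inj_onI)
  fix X Y assume "X \<in> Pow {..<c} \<times> Pow {..<c}" "Y \<in> Pow {..<c} \<times> Pow {..<c}"
    and "index_subgraph X = index_subgraph Y"
  then have "fst X \<subseteq> {..<c}" "fst Y \<subseteq> {..<c}" "snd X \<subseteq> {..<c}" "snd Y \<subseteq> {..<c}"
    and "p ` fst X = p ` fst Y" "cycle_edge p c ` snd X = cycle_edge p c ` snd Y"
    by (simp_all add: index_subgraph_def mem_Times_iff)
  then have "fst X = fst Y" "snd X = snd Y"
    by (metis inj_on_image_eq_iff[OF p], metis inj_on_image_eq_iff[OF inj_on_cycle_edge])
  then show "X = Y" by (rule prod_eqI)
qed

text \<open>The larger end comes first, so that the admissible pairs form a \<open>SIGMA\<close> set
  whose cardinality is a sum over \<open>b\<close>. The case \<open>a = b\<close> is a single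
  vertex.\<close>

definition path_index :: "nat \<times> nat \<Rightarrow> nat set \<times> nat set" where
  "path_index = (\<lambda>(b, a). ({a..b}, {a..<b}))"

definition wrapped_index :: "nat \<times> nat \<Rightarrow> nat set \<times> nat set" where
  "wrapped_index = (\<lambda>(b, a). ({..a} \<union> {b..<c}, {..<a} \<union> {b..<c}))"

lemma inj_on_path_index: "inj_on path_index (SIGMA b:{..<c}. {..b})"
proof (rule inj_onI; clarify)
  fix b a b' a'
  assume *: "a \<le> b" "a' \<le> b'" and "path_index (b, a) = path_index (b', a')"
  then have "{a..b} = {a'..b'}" by (simp add: path_index_def)
  then show "b = b' \<and> a = a'" using * by simp
qed

text \<open>The edges left out are those with indices in \<open>{a..<b}\<close>; this interval is
  nonempty and determines \<open>a\<close> and \<open>b\<close>.\<close>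

lemma inj_on_wrapped_index: "inj_on wrapped_index (SIGMA b:{..<c}. {..<b})"
proof (rule inj_onI; clarify)
  fix b a b' a'
  assume *: "b < c" "a < b" "b' < c" "a' < b'" and "wrapped_index (b, a) = wrapped_index (b', a')"
  then have "{..<c} - ({..<a} \<union> {b..<c}) = {..<c} - ({..<a'} \<union> {b'..<c})"
    by (simp add: wrapped_index_def)
  moreover have "{..<c} - ({..<a} \<union> {b..<c}) = {a..<b}"
    "{..<c} - ({..<a'} \<union> {b'..<c}) = {a'..<b'}" using * by auto
  ultimately have "{a..<b} = {a'..<b'}" by simp
  then show "b = b' \<and> a = a'" using * by (simp add: atLeastLessThan_eq_iff)
qed

lemma index_subgraph_connected:
  assumes "X \<in> path_index ` (SIGMA b:{..<c}. {..b}) \<or>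
    X \<in> wrapped_index ` (SIGMA b:{..<c}. {..<b}) \<or> X = ({..<c}, {..<c})"
  shows "index_subgraph X \<in> connected_subgraphs (cycle p c)"
proof -
  have "connected_graph (index_subgraph X)"
    using assms connected_graph_path connected_graph_wrapped_path connected_graph_cycle
    by (auto simp: index_subgraph_def path_index_def wrapped_index_def cycle_def)
  moreover have "fst X \<subseteq> {..<c}" "snd X \<subseteq> {..<c}"
    using assms by (auto simp: path_index_def wrapped_index_def)
  moreover have "i \<in> fst X \<and> Suc i mod c \<in> fst X" if "i \<in> snd X" for i
    using assms that c by (auto simp: path_index_def wrapped_index_def mod_Suc)
  ultimately show ?thesis
    by (intro connected_subgraphsI) (auto simp: index_subgraph_def cycle_def cycle_edge_def)
qed

text \<open>Paths omit the edge \<open>c - 1\<close>, which the other kinds contain; a wrapped arc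
  omits edge \<open>a\<close>, the full cycle omits none. The set \<open>A\<close> is kept variable
  so that one count serves both for all paths and for those starting at 0.\<close>

lemma card_cycle_indices:
  assumes "A \<subseteq> (SIGMA b:{..<c}. {..b})"
  shows "card (path_index ` A \<union> (wrapped_index ` (SIGMA b:{..<c}. {..<b}) \<union> {({..<c}, {..<c})}))
    = card A + ((\<Sum>b<c. b) + 1)" (is "card (?P \<union> (?W \<union> {?T})) = _")
proof -
  have fin: "finite A" by (rule finite_subset[OF assms]) auto
  have "c - 1 \<notin> snd X" if "X \<in> ?P" for X using that assms by (force simp: path_index_def)
  moreover have "c - 1 \<in> snd X" if "X \<in> ?W \<union> {?T}" for X
    using that c by (auto simp: wrapped_index_def)
  ultimately have "?P \<inter> (?W \<union> {?T}) = {}" by blast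
  moreover have "?T \<notin> ?W"
  proof
    assume "?T \<in> ?W"
    then obtain a b where "a < b" "b < c" "{..<c} = {..<a} \<union> {b..<c}"
      by (auto simp: wrapped_index_def)
    then have "a \<in> {..<a} \<union> {b..<c}" by (metis lessThan_iff less_trans)
    with \<open>a < b\<close> show False by simp
  qed
  moreover have "card ?P = card A"
    by (rule card_image) (rule inj_on_subset[OF inj_on_path_index assms])
  moreover have "card ?W = (\<Sum>b<c. b)"
    by (simp add: card_image[OF inj_on_wrapped_index])
  ultimately show ?thesis using fin by (simp add: card_Un_disjoint del: Un_insert_right)
qed

lemma card_index_subgraphs:
  assumes "I \<subseteq> path_index ` (SIGMA b:{..<c}. {..b}) \<union>
    (wrapped_index ` (SIGMA b:{..<c}. {..<b}) \<union> {({..<c}, {..<c})})"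
  shows "card (index_subgraph ` I) = card I"
proof (rule card_image, rule inj_on_subset[OF inj_on_index_subgraph])
  show "I \<subseteq> Pow {..<c} \<times> Pow {..<c}"
    using assms by (rule order_trans) (auto simp: path_index_def wrapped_index_def)
qed

text \<open>There are \<open>c * (c + 1) / 2\<close> paths, \<open>c * (c - 1) / 2\<close> wrapped
  arcs and the cycle itself.\<close>

lemma core_index_cycle: "core_index (cycle p c) \<ge> c * c + 1"
proof -
  let ?A = "SIGMA b:{..<c}. {..b}"
  define I where "I = path_index ` ?A \<union> (wrapped_index ` (SIGMA b:{..<c}. {..<b}) \<union> {({..<c}, {..<c})})"
  have "index_subgraph ` I \<subseteq> connected_subgraphs (cycle p c)"
    unfolding I_def using index_subgraph_connected by blast
  then have "card (index_subgraph ` I) \<le> core_index (cycle p c)"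
    unfolding core_index_def
    by (intro card_mono finite_connected_subgraphs simple_graph_cycle)
  moreover have "card (index_subgraph ` I) = card I"
    by (rule card_index_subgraphs) (simp only: I_def order_refl)
  moreover have "card ?A = (\<Sum>b<c. b) + c"
    using sum_Suc[of "\<lambda>b. b" "{..<c}"] by simp
  ultimately show ?thesis
    using card_cycle_indices[of ?A, folded I_def, OF order_refl] two_sum_lessThan[of c] by linarith
qed

text \<open>Index 0 lies on the \<open>c\<close> paths that start there, on every wrapped arc and on
  the cycle, which makes \<open>c + c * (c - 1) / 2 + 1\<close>.\<close>

lemma card_connected_subgraphs_at_cycle_start:
  "2 * card (connected_subgraphs_at (cycle p c) (p 0)) \<ge> c * (c + 1) + 2"
proof -
  let ?A = "(\<lambda>b. (b, 0 :: nat)) ` {..<c}"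
  define I where "I = path_index ` ?A \<union> (wrapped_index ` (SIGMA b:{..<c}. {..<b}) \<union> {({..<c}, {..<c})})"
  have A: "?A \<subseteq> (SIGMA b:{..<c}. {..b})" by auto
  have "index_subgraph X \<in> connected_subgraphs_at (cycle p c) (p 0)" if "X \<in> I" for X
  proof -
    have "index_subgraph X \<in> connected_subgraphs (cycle p c)"
      by (rule index_subgraph_connected) (use that A in \<open>unfold I_def, blast\<close>)
    moreover have "0 \<in> fst X" using that c by (auto simp: I_def path_index_def wrapped_index_def)
    ultimately show ?thesis by (auto simp: connected_subgraphs_at_def index_subgraph_def)
  qed
  then have "index_subgraph ` I \<subseteq> connected_subgraphs_at (cycle p c) (p 0)" by blast
  then have "card (index_subgraph ` I) \<le> card (connected_subgraphs_at (cycle p c) (p 0))"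
    by (intro card_mono finite_connected_subgraphs_at simple_graph_cycle)
  moreover have "card (index_subgraph ` I) = card I"
    by (rule card_index_subgraphs) (use A in \<open>unfold I_def, blast\<close>)
  moreover have "card ?A = c" by (simp add: card_image inj_on_def)
  moreover have "c * (c + 1) = c * c + c" by simp
  ultimately show ?thesis
    using card_cycle_indices[OF A, folded I_def] two_sum_lessThan[of c] by linarith
qed

end

text \<open>Rotating the numbering moves any chosen vertex to index 0 without changing the
  cycle.\<close>

lemma cycle_start_wlog:
  assumes "inj_on p {..<c}" "w \<in> verts (cycle p c)"
  obtains q where "inj_on q {..<c}" "cycle q c = cycle p c" "w = q 0"
proof -
  from assms(2) obtain k where k: "k < c" "w = p k" by (auto simp: cycle_def)
  show thesis
    by (rule that[of "\<lambda>i. p ((k + i) mod c)"])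
      (use k assms(1) in \<open>simp_all add: cycle_rotate inj_on_cycle_rotate\<close>)
qed

lemma card_connected_subgraphs_at_cycle:
  assumes "c \<ge> 3" "inj_on p {..<c}" "w \<in> verts (cycle p c)"
  shows "2 * card (connected_subgraphs_at (cycle p c) w) \<ge> c * (c + 1) + 2"
  using assms by (metis cycle_start_wlog card_connected_subgraphs_at_cycle_start)

section \<open>The lower bound\<close>

text \<open>Induction on the number of vertices still missing from \<open>U\<close>, attaching one
  leaf each time. The bound \<open>at\<close> is carried for all vertices, since the place of
  attachment cannot be chosen.\<close>

lemma core_index_lower_bound_extend:
  assumes G: "simple_graph G" "connected_graph G"
    and U: "simple_graph U" "connected_graph U" "verts U \<subseteq> verts G" "edges U \<subseteq> edges G"
    and at: "\<And>x. x \<in> verts U \<Longrightarrow> card (connected_subgraphs_at U x) \<ge> card (verts U) + 4"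
    and core: "2 * core_index U + 16 \<ge> card (verts U) * card (verts U) + 9 * card (verts U)"
  shows "2 * core_index G + 16 \<ge> card (verts G) * card (verts G) + 9 * card (verts G)"
  using U at core
proof (induction "card (verts G - verts U)" arbitrary: U)
  case 0
  have "finite (verts G)" using G by (simp add: simple_graph_def)
  with 0 have "verts U = verts G" by auto
  \<comment> \<open>Now \<open>U\<close> spans \<open>G\<close> but may lack edges, so monotonicity
    finishes.\<close>
  with 0 core_index_mono[OF G(1), of U] show ?case by simp
next
  case (Suc k)
  have fin: "finite (verts G)" "finite (verts U)"
    using G Suc.prems by (auto simp: simple_graph_def)
  have "verts U \<subset> verts G"
    using Suc.hyps(2) Suc.prems(3) by (metis Diff_cancel card.empty nat.distinct(1) psubsetI)
  moreover have "verts U \<noteq> {}" using Suc.prems(2) by (simp add: connected_graph_def)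
  ultimately obtain v w where vw: "v \<in> verts G - verts U" "w \<in> verts U" "{v, w} \<in> edges G"
    by (rule connected_graph_exit_edge[OF G])
  have v: "v \<notin> verts U" using vw by simp
  note leaf = Suc.prems(1) v vw(2)
  let ?U = "add_leaf U v w"
  have card: "card (verts ?U) = Suc (card (verts U))" using v fin by simp
  show ?case
  proof (rule Suc.hyps(1)[of ?U])
    have "verts G - verts ?U = (verts G - verts U) - {v}" by auto
    then show "k = card (verts G - verts ?U)" using Suc.hyps(2) vw(1) fin by simp
    show "simple_graph ?U" by (rule simple_graph_add_leaf[OF leaf])
    show "connected_graph ?U" by (rule connected_graph_add_leaf[OF Suc.prems(2) vw(2)])
    show "verts ?U \<subseteq> verts G" "edges ?U \<subseteq> edges G" using vw Suc.prems by auto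
  next
    fix x assume "x \<in> verts ?U"
    then consider "x = v" | "x \<in> verts U" by auto
    then show "card (verts ?U) + 4 \<le> card (connected_subgraphs_at ?U x)"
    proof cases
      case 1
      then show ?thesis
        using card Suc.prems(5)[OF vw(2)] card_connected_subgraphs_at_new_leaf[OF leaf] by simp
    next
      case 2
      then show ?thesis
        using card Suc.prems(5)[OF 2] card_connected_subgraphs_at_add_leaf[OF leaf Suc.prems(2) 2]
        by simp
    qed
  next
    show "card (verts ?U) * card (verts ?U) + 9 * card (verts ?U) \<le> 2 * core_index ?U + 16"
      \<comment> \<open>With \<open>m\<close> vertices in \<open>U\<close>, the leaf adds at least
        \<open>m + 5\<close>, and \<open>2 * (m + 5)\<close> is the increment of
        \<open>m * m + 9 * m\<close>.\<close>
      using Suc.prems(5)[OF vw(2)] Suc.prems(6) core_index_add_leaf[OF leaf] card by simp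
  qed
qed

text \<open>A longest path has a non-pendant end; a second neighbour of that end lies on the path and
  closes a cycle.\<close>

lemma exists_cycle:
  assumes G: "simple_graph G" "connected_graph G" and n: "card (verts G) \<ge> 2"
    and one: "\<And>u v. pendant G u \<Longrightarrow> pendant G v \<Longrightarrow> u = v"
  obtains p c where "c \<ge> 3" "inj_on p {..<c}" "verts (cycle p c) \<subseteq> verts G"
    "edges (cycle p c) \<subseteq> edges G"
proof -
  define path where "path xs \<longleftrightarrow> distinct xs \<and> set xs \<subseteq> verts G \<and>
    successively (\<lambda>u v. {u, v} \<in> edges G) xs" for xs
  have E: "e \<subseteq> verts G" "card e = 2" if "e \<in> edges G" for e
    using G that by (auto simp: simple_graph_def)
  have fin: "finite (verts G)" using G by (simp add: simple_graph_def)
  have len: "length xs \<le> card (verts G)" if "path xs" for xs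
    using that fin by (metis card_mono distinct_card path_def)
  obtain u x where ux: "u \<in> verts G" "x \<in> verts G" "u \<noteq> x"
    using n by (metis card_le_Suc0_iff_eq fin not_less_eq_eq numeral_2_eq_2)
  obtain y where uy: "{u, y} \<in> edges G"
    using connected_graph_incident_edge[OF G(2) ux] .
  have path2: "path [u, y]" using uy E[OF uy] by (auto simp: path_def)
  obtain xs where xs: "path xs" and max: "\<And>ys. path ys \<Longrightarrow> length ys \<le> length xs"
    using ex_has_greatest_nat[of path "[u, y]" length "Suc (card (verts G))"] path2 len
    by (auto simp: less_Suc_eq_le)
  have len2: "length xs \<ge> 2" using max[OF path2] by simp
  have rev: "path (rev xs)"
    using xs by (simp add: path_def insert_commute)
  \<comment> \<open>The two ends differ, so at most one is pendant; reversing if necessary puts a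
    non-pendant end first.\<close>
  have "hd xs \<noteq> hd (rev xs)"
  proof
    assume "hd xs = hd (rev xs)"
    then have "hd xs = last xs" by (simp add: hd_rev)
    moreover obtain a b zs where "xs = a # b # zs"
      using len2 by (metis Suc_le_length_iff numeral_2_eq_2)
    ultimately show False using xs by (auto simp: path_def split: if_splits)
  qed
  then have "\<not> pendant G (hd xs) \<or> \<not> pendant G (hd (rev xs))" using one by blast
  then obtain ys where ys: "path ys" "length ys = length xs" and np: "\<not> pendant G (hd ys)"
    using xs rev by auto
  obtain a b zs where abz: "ys = a # b # zs"
    using len2 ys(2) by (metis Suc_le_length_iff numeral_2_eq_2)
  have ab: "{a, b} \<in> edges G" and aV: "a \<in> verts G" using ys(1) by (auto simp: path_def abz)
  have "\<exists>z. {a, z} \<in> edges G \<and> z \<noteq> b"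
  proof (rule ccontr)
    assume "\<nexists>z. {a, z} \<in> edges G \<and> z \<noteq> b"
    then have only: "z = b" if "{a, z} \<in> edges G" for z using that by blast
    have "{e \<in> edges G. a \<in> e} = {{a, b}}"
    proof
      show "{e \<in> edges G. a \<in> e} \<subseteq> {{a, b}}"
      proof
        fix e assume e: "e \<in> {e \<in> edges G. a \<in> e}"
        then obtain z where "e = {a, z}"
          using E(2)[of e] by (auto simp: card_2_iff)
        with e only show "e \<in> {{a, b}}" by auto
      qed
    qed (use ab in auto)
    then have "pendant G a" using aV by (simp add: pendant_def degree_def)
    with np abz show False by simp
  qed
  then obtain z where z: "{a, z} \<in> edges G" "z \<noteq> b" by blast
  have za: "z \<noteq> a" using E(2)[OF z(1)] by auto
  \<comment> \<open>Otherwise \<open>z\<close> would prolong the longest path at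
    \<open>a\<close>.\<close>
  have "z \<in> set ys"
  proof (rule ccontr)
    assume "z \<notin> set ys"
    then have "path (z # ys)"
      using ys(1) z E(1)[OF z(1)] by (auto simp: path_def abz insert_commute)
    from max[OF this] ys(2) show False by simp
  qed
  then obtain k where k: "k < length ys" "z = ys ! k" by (auto simp: in_set_conv_nth)
  \<comment> \<open>Positions 0 and 1 hold \<open>a\<close> and \<open>b\<close>, so the cycle on
    positions \<open>0, ..., k\<close> has at least three vertices.\<close>
  have "k \<noteq> 0" "k \<noteq> 1" using k(2) z(2) za by (auto simp: abz intro: gr0I)
  then have k2: "k \<ge> 2" by simp
  have edge: "{ys ! i, ys ! Suc i} \<in> edges G" if "Suc i < length ys" for i
    using ys(1) that by (auto simp: path_def successively_conv_nth)
  show thesis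
  proof (rule that[of "Suc k" "\<lambda>i. ys ! i"])
    show "3 \<le> Suc k" using k2 by simp
    show "inj_on (\<lambda>i. ys ! i) {..<Suc k}"
      using ys(1) k by (auto simp: path_def inj_on_def nth_eq_iff_index_eq)
    show "verts (cycle ((!) ys) (Suc k)) \<subseteq> verts G"
      using ys(1) k by (auto simp: path_def cycle_def)
    have "cycle_edge ((!) ys) (Suc k) i \<in> edges G" if "i < Suc k" for i
    proof (cases "i = k")
      case True
      then show ?thesis using z k by (simp add: cycle_edge_def abz insert_commute)
    next
      case False
      then show ?thesis using that k edge by (simp add: cycle_edge_def)
    qed
    then show "edges (cycle ((!) ys) (Suc k)) \<subseteq> edges G"
      by (auto simp: cycle_def)
  qed
qed

text \<open>After rotation the vertex has index 0 and lies on the edges 0 and \<open>c - 1\<close>,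
  which are different, contradicting degree one.\<close>

lemma pendant_notin_cycle:
  assumes c: "c \<ge> 3" and p: "inj_on p {..<c}" and E: "edges (cycle p c) \<subseteq> edges G"
    and v: "pendant G v"
  shows "v \<notin> verts (cycle p c)"
proof
  assume "v \<in> verts (cycle p c)"
  with p obtain q where q: "inj_on q {..<c}" "cycle q c = cycle p c" "v = q 0"
    by (rule cycle_start_wlog)
  have e: "cycle_edge q c 0 \<in> edges G" "cycle_edge q c (c - 1) \<in> edges G"
    using E c unfolding q(2)[symmetric] by (auto simp: cycle_def)
  have "v \<in> cycle_edge q c 0" "v \<in> cycle_edge q c (c - 1)"
    using c q(3) by (simp_all add: cycle_edge_def)
  moreover obtain d where "{e \<in> edges G. v \<in> e} = {d}"
    using v by (auto simp: pendant_def degree_def card_1_singleton_iff)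
  ultimately have "cycle_edge q c 0 \<in> {d}" "cycle_edge q c (c - 1) \<in> {d}"
    using e by (metis (mono_tags, lifting) mem_Collect_eq)+
  then have "cycle_edge q c 0 = cycle_edge q c (c - 1)" by simp
  from inj_onD[OF inj_on_cycle_edge[OF c q(1)] this] c show False by simp
qed

lemma core_index_one_pendant_lower_bound:
  assumes "one_pendant_graph n G" "n \<ge> 2"
  shows "2 * core_index G + 16 \<ge> n * n + 9 * n"
proof -
  have G: "simple_graph G" "connected_graph G" and n: "card (verts G) = n"
    and "card {v. pendant G v} = 1"
    using assms by (auto simp: one_pendant_graph_def)
  then obtain v0 where "{v. pendant G v} = {v0}" by (auto simp: card_1_singleton_iff)
  then have v0: "pendant G v \<longleftrightarrow> v = v0" for v by (simp add: set_eq_iff)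
  obtain p c where c: "c \<ge> 3" and p: "inj_on p {..<c}"
    and C: "verts (cycle p c) \<subseteq> verts G" "edges (cycle p c) \<subseteq> edges G"
  proof (rule exists_cycle[OF G])
    show "2 \<le> card (verts G)" using n assms(2) by simp
    show "u = v" if "pendant G u" "pendant G v" for u v using that v0 by auto
  qed
  have "pendant G v0" using v0 by auto
  then have "v0 \<in> verts G - verts (cycle p c)"
    using pendant_notin_cycle[OF c p C(2)] by (auto simp: pendant_def)
  then have "verts (cycle p c) \<subset> verts G" using C(1) by blast
  moreover have "verts (cycle p c) \<noteq> {}" using c by (auto simp: cycle_def lessThan_empty_iff)
  ultimately obtain v w
    where vw: "v \<in> verts G - verts (cycle p c)" "w \<in> verts (cycle p c)" "{v, w} \<in> edges G"
    by (rule connected_graph_exit_edge[OF G])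
  have leaf: "simple_graph (cycle p c)" "v \<notin> verts (cycle p c)" "w \<in> verts (cycle p c)"
    using simple_graph_cycle[OF c p] vw by auto
  note conn = connected_graph_cycle[OF c p]
  let ?U = "add_leaf (cycle p c) v w"
  have cardC: "card (verts (cycle p c)) = c" using p by (simp add: cycle_def card_image)
  then have card: "card (verts ?U) = Suc c"
    using leaf by (simp add: simple_graph_def)
  have at: "card (connected_subgraphs_at (cycle p c) x) \<ge> c + 4" if "x \<in> verts (cycle p c)" for x
  proof -
    \<comment> \<open>Twice the count is at least \<open>4 * c + 2\<close>, which is at least
      \<open>2 * (c + 4)\<close> for \<open>c \<ge> 3\<close>.\<close>
    have "c * (c + 1) \<ge> 3 * c + c" using mult_le_mono1[OF c, of c] by simp
    then show ?thesis using card_connected_subgraphs_at_cycle[OF c p that] c by linarith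
  qed
  have "2 * core_index G + 16 \<ge> card (verts G) * card (verts G) + 9 * card (verts G)"
  \<comment> \<open>The growth starts from the cycle with one leaf: for the cycle alone, the bound
    \<open>c * c + 1\<close> would leave the difference \<open>(c - 3) * (c - 6)\<close>, negative
    for \<open>c = 4\<close> and \<open>c = 5\<close>.\<close>
  proof (rule core_index_lower_bound_extend[OF G, of ?U])
    show "simple_graph ?U" by (rule simple_graph_add_leaf[OF leaf])
    show "connected_graph ?U" by (rule connected_graph_add_leaf[OF conn vw(2)])
    show "verts ?U \<subseteq> verts G" "edges ?U \<subseteq> edges G" using vw C by auto
  next
    fix x assume "x \<in> verts ?U"
    then consider "x = v" | "x \<in> verts (cycle p c)" by auto
    then show "card (verts ?U) + 4 \<le> card (connected_subgraphs_at ?U x)"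
    proof cases
      case 1
      then show ?thesis
        using card at[OF vw(2)] card_connected_subgraphs_at_new_leaf[OF leaf] by simp
    next
      case 2
      then show ?thesis
        using card at[OF 2] card_connected_subgraphs_at_add_leaf[OF leaf conn 2] by simp
    qed
  next
    obtain d where d: "c = 3 + d" using c le_Suc_ex by blast
    have "2 * core_index ?U \<ge> 2 * (c * c + 1) + 2 + (c * (c + 1) + 2)"
      using core_index_add_leaf[OF leaf] core_index_cycle[OF c p]
        card_connected_subgraphs_at_cycle[OF c p vw(2)] by simp
    \<comment> \<open>The right side exceeds the left by
      \<open>2 * (c - 2) * (c - 3) = 2 * d * (d + 1)\<close>, with equality for the triangle;
      substituting \<open>3 + d\<close> leaves only nonnegative coefficients.\<close>
    moreover have "Suc c * Suc c + 9 * Suc c \<le> 2 * (c * c + 1) + 2 + (c * (c + 1) + 2) + 16"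
      unfolding d by (simp add: algebra_simps)
    ultimately show "card (verts ?U) * card (verts ?U) + 9 * card (verts ?U) \<le> 2 * core_index ?U + 16"
      unfolding card by linarith
  qed
  then show ?thesis by (simp add: n)
qed

section \<open>The pendant vertex of the lollipop, and the conclusion\<close>

text \<open>Every vertex except the end of the path lies on two different edges: two triangle edges
  for 0, 1 and 2, and two consecutive path edges otherwise.\<close>

lemma pendant_lollipop:
  assumes "n \<ge> 4"
  shows "pendant (lollipop n) v \<longleftrightarrow> v = n - 1"
proof -
  have path: "{i, i + 1} \<in> edges (lollipop n)" if "2 \<le> i" "i + 1 < n" for i
    using that by (auto simp: lollipop_def)
  have tri: "{0, 1} \<in> edges (lollipop n)" "{1, 2} \<in> edges (lollipop n)" "{0, 2} \<in> edges (lollipop n)"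
    by (auto simp: lollipop_def)
  have two: "\<not> pendant (lollipop n) v"
    if "e \<in> edges (lollipop n)" "f \<in> edges (lollipop n)" "v \<in> e" "v \<in> f" "e \<noteq> f" for e f
  proof
    assume "pendant (lollipop n) v"
    then obtain d where "{e \<in> edges (lollipop n). v \<in> e} = {d}"
      by (auto simp: pendant_def degree_def card_1_singleton_iff)
    with that have "e \<in> {d}" "f \<in> {d}" by (metis (mono_tags, lifting) mem_Collect_eq)+
    with that show False by simp
  qed
  have "{e \<in> edges (lollipop n). n - 1 \<in> e} = {{n - 2, n - 1}}"
  proof
    have "e = {n - 2, n - 1}" if e: "e \<in> edges (lollipop n)" "n - 1 \<in> e" for e
    proof -
      \<comment> \<open>As \<open>n - 1 \<ge> 3\<close>, the vertex is off the triangle, so only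
        path edges remain.\<close>
      from e assms obtain i where "e = {i, i + 1}" "2 \<le> i" "i + 1 < n" "n - 1 \<in> {i, i + 1}"
        by (auto simp: lollipop_def)
      moreover from this have "i = n - 2" "i + 1 = n - 1" by auto
      ultimately show ?thesis by simp
    qed
    then show "{e \<in> edges (lollipop n). n - 1 \<in> e} \<subseteq> {{n - 2, n - 1}}" by blast
    have "n - 2 + 1 = n - 1" using assms by simp
    then show "{{n - 2, n - 1}} \<subseteq> {e \<in> edges (lollipop n). n - 1 \<in> e}"
      using path[of "n - 2"] assms by simp
  qed
  then have last: "pendant (lollipop n) (n - 1)"
    using assms by (simp add: pendant_def degree_def)
  have "\<not> pendant (lollipop n) v" if "v \<noteq> n - 1"
  proof -
    from that consider "v = 0" | "v = 1" | "v = 2" | "3 \<le> v" "v < n - 1" | "v \<ge> n"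
      by linarith
    then show ?thesis
    proof cases
      case 1
      then show ?thesis using two[OF tri(1) tri(3)] by (simp add: doubleton_eq_iff)
    next
      case 2
      then show ?thesis using two[OF tri(1) tri(2)] by (simp add: doubleton_eq_iff)
    next
      case 3
      then show ?thesis using two[OF tri(2) tri(3)] by (simp add: doubleton_eq_iff)
    next
      case 4
      then show ?thesis
        using two[OF path[of "v - 1"] path[of v]] by (simp add: doubleton_eq_iff)
    next
      case 5
      then show ?thesis by (simp add: pendant_def)
    qed
  qed
  with last show ?thesis by blast
qed

theorem theorem5p6:
  fixes n :: nat
  assumes "n \<ge> 4"
  shows "one_pendant_graph n (lollipop n) \<and>
         (\<forall>G :: 'a ugraph. one_pendant_graph n G \<longrightarrow> core_index (lollipop n) \<le> core_index G)"
proof (intro conjI allI impI)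
  show "one_pendant_graph n (lollipop n)"
    using assms simple_connected_lollipop[of n] pendant_lollipop[OF assms]
    by (simp add: one_pendant_graph_def)
next
  fix G :: "'a ugraph" assume "one_pendant_graph n G"
  then have "n * n + 9 * n \<le> 2 * core_index G + 16"
    using assms by (intro core_index_one_pendant_lower_bound) simp_all
  moreover have "2 * core_index (lollipop n) + 16 \<le> n * n + 9 * n"
    using lollipop_counts[of n] assms by simp
  ultimately show "core_index (lollipop n) \<le> core_index G" by simp
qed

end
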